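(* Let $k,m,n\in\mathbb{N}$ and let $A:\mathbb{R}^m\to\mathbb{R}^n$ be a linear operator satisfying $\mathrm{rank}(A)>k$. Then there exists a subset $\sigma\subseteq\{1,\ldots,m\}$ with $|\sigma|=k$ such that $$\|(AJ_\sigma)^{-1}\|_{S_\infty}\le\frac{\sqrt m}{\sqrt{\mathrm{rank}(A)}-\sqrt k}\left(\frac{1}{\mathrm{rank}(A)}\sum_{i=1}^{\mathrm{rank}(A)}\frac{1}{s_i(A)^2}\right)^{1/2}.$$
   Context: $\mathbb{N}=\{1,2,\ldots\}$; $e_1,\ldots,e_m$ is the standard basis of $\mathbb{R}^m$. For a linear operator $A:\mathbb{R}^m\to\mathbb{R}^n$, $s_1(A)\ge\cdots\ge s_m(A)\ge 0$ are its singular values, i.e. the eigenvalues, in decreasing order and with multiplicity, of $\sqrt{A^*A}$. $\|\cdot\|_{S_\infty}$ is the operator norm with respect to Euclidean norms. For $\sigma\subseteq\{1,\ldots,m\}$, $J_\sigma:\mathbb{R}^\sigma\to\mathbb{R}^m$ is the inclusion $J_\sigma((a_j)_{j\in\sigma})=\sum_{j\in\sigma}a_je_j$. If $AJ_\sigma$ is injective, $(AJ_\sigma)^{-1}:A(\mathbb{R}^\sigma)\to\mathbb{R}^\sigma$ denotes the inverse of $AJ_\sigma$ defined on its image; if $AJ_\sigma$ is not injective, one sets $\|(AJ_\sigma)^{-1}\|_{S_\infty}=\infty$. *)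

theory Defs
  imports "HOL-Analysis.Analysis" "HOL-Library.Multiset"
begin

definition positive_operator :: "('a::euclidean_space \<Rightarrow> 'a) \<Rightarrow> bool" where
  "positive_operator T \<longleftrightarrow>
     linear T \<and> (\<forall>x y. T x \<bullet> y = x \<bullet> T y) \<and> (\<forall>x. 0 \<le> T x \<bullet> x)"

text \<open>Meaningful for positive \<open>T\<close>, where a positive square root exists and is unique.\<close>

definition operator_sqrt :: "('a::euclidean_space \<Rightarrow> 'a) \<Rightarrow> ('a \<Rightarrow> 'a)" where
  "operator_sqrt T = (THE B. positive_operator B \<and> B \<circ> B = T)"

definition eigenspace :: "('a::euclidean_space \<Rightarrow> 'a) \<Rightarrow> real \<Rightarrow> 'a set" where
  "eigenspace B c = {v. B v = c *\<^sub>R v}"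

definition eigenvalues :: "('a::euclidean_space \<Rightarrow> 'a) \<Rightarrow> real set" where
  "eigenvalues B = {c. \<exists>v. v \<noteq> 0 \<and> B v = c *\<^sub>R v}"

text \<open>Multiplicity is the dimension of the eigenspace; for self-adjoint operators, the only
  ones considered here, this agrees with the algebraic multiplicity. A linear operator on a
  Euclidean space has finitely many eigenvalues, so the sum ranges over a finite set.\<close>

definition eigenvalue_mset :: "('a::euclidean_space \<Rightarrow> 'a) \<Rightarrow> real multiset" where
  "eigenvalue_mset B = (\<Sum>c\<in>eigenvalues B. replicate_mset (dim (eigenspace B c)) c)"

text \<open>The index starts at 1, so that \<open>singular_value A 1\<close> is the largest singular value;
  values at indices outside \<open>{1..DIM('a)}\<close> carry no meaning.\<close>

definition singular_value ::
    "('a::euclidean_space \<Rightarrow> 'b::euclidean_space) \<Rightarrow> nat \<Rightarrow> real" where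
  "singular_value A i =
     rev (sorted_list_of_multiset (eigenvalue_mset (operator_sqrt (adjoint A \<circ> A)))) ! (i - 1)"

text \<open>The space \<open>\<real>\<^sup>\<sigma>\<close> is rendered as \<open>extensional \<sigma>\<close>, i.e. real functions that are
  \<open>undefined\<close> off \<open>\<sigma>\<close>; its Euclidean norm is \<open>\<lambda>a. L2_set a \<sigma>\<close>.\<close>

definition coord_incl :: "'m::finite set \<Rightarrow> ('m \<Rightarrow> real) \<Rightarrow> real ^ 'm" where
  "coord_incl \<sigma> a = (\<Sum>j\<in>\<sigma>. a j *\<^sub>R axis j 1)"

text \<open>The operator norm of the inverse of \<open>A \<circ> coord_incl \<sigma>\<close> on its image, as the same supremum
  of quotients that defines \<^const>\<open>onorm\<close> (the quotient at 0 is 0).\<close>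

definition inv_restr_norm ::
    "(real ^ 'm::finite \<Rightarrow> real ^ 'n::finite) \<Rightarrow> 'm set \<Rightarrow> ereal" where
  "inv_restr_norm A \<sigma> =
     (let AJ = A \<circ> coord_incl \<sigma>; R\<sigma> = (extensional \<sigma> :: ('m \<Rightarrow> real) set) in
      if inj_on AJ R\<sigma>
      then (SUP y \<in> AJ ` R\<sigma>. ereal (L2_set (inv_into R\<sigma> AJ y) \<sigma> / norm y))
      else \<infinity>)"

end

theory Submission
  imports Defs
begin

text \<open>Put \<open>G = A\<^sup>* A\<close> and remove columns of \<open>A\<close> one at a time, starting from a barrier \<open>c = -a < 0\<close>.
  For the compression of \<open>G\<close> to the remaining coordinates, with eigenvalues \<open>\<lambda>\<^sub>i > c\<close>,
  let \<open>\<phi> = \<Sum>\<^sub>i 1 / (\<lambda>\<^sub>i - c)\<close>. Since \<open>\<phi> > 1 / (\<lambda>\<^sub>i - c)\<close> for each \<open>i\<close>, the shifted barrier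
  \<open>c' = c + 1 / \<phi>\<close> is still below all \<open>\<lambda>\<^sub>i\<close>, and hence below the spectrum of every further
  compression. Removing the coordinate \<open>e\<close> lowers the trace of \<open>N = (G - c')\<^sup>-\<^sup>1\<close> by
  \<open>(N\<^sup>2)\<^sub>e\<^sub>e / N\<^sub>e\<^sub>e\<close>; averaging over \<open>e\<close> with weights \<open>N\<^sub>e\<^sub>e\<close> and using Chebyshev's sum inequality,
  some \<open>e\<close> brings the trace back to at most \<open>\<phi>\<close>. After \<open>m - k\<close> removals the smallest
  eigenvalue is at least \<open>(m - k) / \<phi> - a\<close> for the initial \<open>\<phi>\<close>. With \<open>r\<close> the rank and \<open>h\<close> the
  mean of the \<open>1 / s\<^sub>i\<^sup>2\<close>, the choice \<open>a = (sqrt (r / k) - 1) / h\<close> makes this at least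
  \<open>(sqrt r - sqrt k)\<^sup>2 / (m h)\<close>.\<close>

subsection \<open>Orthonormal bases and compressions\<close>

definition orthonormal :: "'a::euclidean_space set \<Rightarrow> bool" where
  "orthonormal B \<longleftrightarrow> pairwise orthogonal B \<and> (\<forall>b\<in>B. norm b = 1)"

lemma orthonormal_inner:
  assumes "orthonormal B" "b \<in> B" "c \<in> B"
  shows "b \<bullet> c = (if b = c then 1 else 0)"
proof (cases "b = c")
  case True
  then show ?thesis
    using assms by (simp add: orthonormal_def dot_square_norm)
next
  case False
  then show ?thesis
    using assms by (auto simp: orthonormal_def pairwise_def orthogonal_def)
qed

lemma orthonormal_finite: "orthonormal B \<Longrightarrow> finite B"
  by (simp add: orthonormal_def pairwise_orthogonal_imp_finite)

lemma orthonormal_subset: "orthonormal B \<Longrightarrow> C \<subseteq> B \<Longrightarrow> orthonormal C"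
  by (auto simp: orthonormal_def pairwise_def)

lemma orthonormal_independent: "orthonormal B \<Longrightarrow> independent B"
  by (rule pairwise_orthogonal_independent) (auto simp: orthonormal_def)

lemma orthonormal_card: "orthonormal B \<Longrightarrow> card B = dim (span B)"
  by (metis dim_span_eq_card_independent orthonormal_independent)

lemma orthonormal_insert:
  assumes "orthonormal B" "norm e = 1" "\<And>b. b \<in> B \<Longrightarrow> b \<bullet> e = 0"
  shows "orthonormal (insert e B)"
  using assms by (auto simp: orthonormal_def pairwise_def orthogonal_def inner_commute)

lemma orthonormal_inner_sum:
  assumes "orthonormal B" "b \<in> B"
  shows "b \<bullet> (\<Sum>a\<in>B. f a *\<^sub>R a) = f b"
proof -
  have "b \<bullet> (\<Sum>a\<in>B. f a *\<^sub>R a) = (\<Sum>a\<in>B. f a * (if b = a then 1 else 0))"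
    unfolding inner_sum_right
    using assms by (intro sum.cong) (auto simp: orthonormal_inner)
  then show ?thesis
    using orthonormal_finite[OF assms(1)] assms(2) by (simp add: if_distrib cong: if_cong)
qed

lemma orthonormal_expand:
  assumes "orthonormal B" "x \<in> span B"
  shows "x = (\<Sum>b\<in>B. (b \<bullet> x) *\<^sub>R b)"
proof -
  have fin: "finite B"
    using assms(1) by (rule orthonormal_finite)
  then obtain u where u: "x = (\<Sum>b\<in>B. u b *\<^sub>R b)"
    using assms(2) by (auto simp: span_finite)
  have "c \<bullet> x = u c" if "c \<in> B" for c
    unfolding u by (rule orthonormal_inner_sum[OF assms(1) that])
  then show ?thesis
    using u by simp
qed

lemma orthonormal_parseval:
  assumes "orthonormal B" "x \<in> span B"
  shows "x \<bullet> y = (\<Sum>b\<in>B. (b \<bullet> x) * (b \<bullet> y))"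
  by (subst orthonormal_expand[OF assms]) (simp add: inner_sum_left)

lemma orthonormal_parseval_square:
  assumes "orthonormal B" "x \<in> span B"
  shows "(norm x)\<^sup>2 = (\<Sum>b\<in>B. (b \<bullet> x)\<^sup>2)"
  using orthonormal_parseval[OF assms, of x] by (simp add: dot_square_norm power2_eq_square)

lemma orthonormal_inner_nonzero:
  assumes "orthonormal B" "x \<in> span B" "x \<noteq> 0"
  obtains b where "b \<in> B" "b \<bullet> x \<noteq> 0"
proof -
  have "\<exists>b\<in>B. b \<bullet> x \<noteq> 0"
  proof (rule ccontr)
    assume "\<not> ?thesis"
    then have "(\<Sum>b\<in>B. (b \<bullet> x) *\<^sub>R b) = 0"
      by simp
    then show False
      using orthonormal_expand[OF assms(1,2)] assms(3) by simp
  qed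
  then show thesis using that by blast
qed

text \<open>The compression of \<open>G\<close> to \<open>span B\<close> is diagonal in the basis \<open>B\<close>; \<open>span B\<close> need not be
  invariant under \<open>G\<close>.\<close>

definition diagonalizes ::
    "('a::euclidean_space \<Rightarrow> 'a) \<Rightarrow> 'a set \<Rightarrow> ('a \<Rightarrow> real) \<Rightarrow> bool" where
  "diagonalizes G B l \<longleftrightarrow>
     orthonormal B \<and> (\<forall>b\<in>B. \<forall>y\<in>span B. G b \<bullet> y = l b * (b \<bullet> y))"

section \<open>Spectral decomposition of compressions via the Rayleigh quotient\<close>

lemma quadratic_nonneg_imp_zero:
  fixes p q :: real
  assumes "\<And>t. 0 \<le> 2 * t * p + t\<^sup>2 * q"
  shows "p = 0"
proof (rule ccontr)
  assume p: "p \<noteq> 0"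
  define s where "s = \<bar>q\<bar> + 1"
  have s: "s > 0" "q < s" by (auto simp: s_def)
  have "0 \<le> 2 * (- p / s) * p + (- p / s)\<^sup>2 * q"
    using assms by blast
  also have "\<dots> = (p\<^sup>2 / s) * (q / s - 2)"
    using s by (simp add: field_simps power2_eq_square)
  also have "\<dots> < 0"
    using s p by (intro mult_pos_neg) (auto simp: field_simps)
  finally show False by simp
qed

text \<open>The form \<open>G x \<bullet> x\<close> attains its maximum on the compact unit sphere
  of \<open>S\<close>, and at a maximizer the first variation in every direction of \<open>S\<close>
  vanishes. The equation is tested against \<open>S\<close> only, since \<open>G e\<close> may leave
  \<open>S\<close>.\<close>

lemma max_rayleigh_eigenvector:
  fixes G :: "'a::euclidean_space \<Rightarrow> 'a"
  assumes G: "linear G" and sym: "\<And>x y. G x \<bullet> y = x \<bullet> G y"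
    and S: "subspace S" and nz: "S \<noteq> {0}"
  obtains e l where "e \<in> S" "norm e = 1" "\<And>y. y \<in> S \<Longrightarrow> G e \<bullet> y = l * (e \<bullet> y)"
proof -
  let ?K = "S \<inter> sphere 0 1"
  have comp: "compact ?K"
    using S by (intro closed_Int_compact closed_subspace) auto
  obtain x0 where "x0 \<in> S" "x0 \<noteq> 0"
    using nz subspace_0[OF S] by auto
  then have "x0 /\<^sub>R norm x0 \<in> ?K"
    using S by (auto simp: subspace_scale)
  then have ne: "?K \<noteq> {}" by blast
  have "continuous_on ?K (\<lambda>x. G x \<bullet> x)"
    by (intro continuous_intros linear_continuous_on linear_linear[THEN iffD2] G)
  then obtain e where e: "e \<in> ?K" and emax: "\<And>y. y \<in> ?K \<Longrightarrow> G y \<bullet> y \<le> G e \<bullet> e"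
    using continuous_attains_sup[OF comp ne] by blast
  define l where "l = G e \<bullet> e"
  have eS: "e \<in> S" "norm e = 1" using e by auto
  have ee: "e \<bullet> e = 1" using eS by (simp add: dot_square_norm)
  have bound: "G y \<bullet> y \<le> l * (y \<bullet> y)" if y: "y \<in> S" for y
  proof (cases "y = 0")
    case True
    then show ?thesis by (simp add: linear_0[OF G])
  next
    case False
    have "y /\<^sub>R norm y \<in> ?K"
      using S y False by (auto simp: subspace_scale)
    then have "G (y /\<^sub>R norm y) \<bullet> (y /\<^sub>R norm y) \<le> l"
      unfolding l_def by (rule emax)
    then have "(G y \<bullet> y) / (norm y)\<^sup>2 \<le> l"
      by (simp add: linear_scale[OF G] power2_eq_square divide_inverse mult.commute mult.left_commute)
    then show ?thesis
      using False by (simp add: dot_square_norm divide_le_eq)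
  qed
  \<comment> \<open>Applying \<open>bound\<close> to \<open>e + t *\<^sub>R y\<close> yields a
    nonnegative quadratic in \<open>t\<close>. Its constant term vanishes because
    \<open>l = G e \<bullet> e\<close> and \<open>e\<close> is a unit vector, so its linear
    coefficient must vanish too.\<close>
  have "l * (e \<bullet> y) - G e \<bullet> y = 0" if y: "y \<in> S" for y
  proof (rule quadratic_nonneg_imp_zero[where q = "l * (y \<bullet> y) - G y \<bullet> y"])
    fix t :: real
    have "e + t *\<^sub>R y \<in> S"
      using S eS y by (simp add: subspace_add subspace_scale)
    from bound[OF this]
    have "G e \<bullet> e + 2 * t * (G e \<bullet> y) + t\<^sup>2 * (G y \<bullet> y)
        \<le> l * (e \<bullet> e + 2 * t * (e \<bullet> y) + t\<^sup>2 * (y \<bullet> y))"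
      using sym[of y e] sym[of e y]
      by (simp add: linear_add[OF G] linear_scale[OF G] inner_add_left inner_add_right
          inner_commute power2_eq_square algebra_simps)
    then show "0 \<le> 2 * t * (l * (e \<bullet> y) - G e \<bullet> y) + t\<^sup>2 * (l * (y \<bullet> y) - G y \<bullet> y)"
      using ee by (simp add: l_def algebra_simps)
  qed
  then have "G e \<bullet> y = l * (e \<bullet> y)" if "y \<in> S" for y
    using that by fastforce
  then show thesis
    by (rule that[OF eS])
qed

lemma subspace_perp_insert:
  assumes S: "subspace S" and e: "e \<in> S" "norm e = 1" and B: "span B = {y \<in> S. y \<bullet> e = 0}"
  shows "span (insert e B) = S"
proof
  have "B \<subseteq> S"
    using span_superset[of B] B by auto
  then show "span (insert e B) \<subseteq> S"
    using S e by (intro span_minimal) auto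
next
  show "S \<subseteq> span (insert e B)"
  proof
    fix x assume x: "x \<in> S"
    have ee: "e \<bullet> e = 1" using e by (simp add: dot_square_norm)
    have "x - (x \<bullet> e) *\<^sub>R e \<in> span B"
      using S x e ee by (auto simp: B subspace_diff subspace_scale inner_diff_left)
    then show "x \<in> span (insert e B)"
      by (auto simp: span_insert)
  qed
qed

text \<open>Induction on the dimension: split off a maximizer \<open>e\<close> of the Rayleigh
  quotient and continue in its orthogonal complement within \<open>S\<close>.\<close>

lemma exists_diagonalizes:
  fixes G :: "'a::euclidean_space \<Rightarrow> 'a"
  assumes G: "linear G" and sym: "\<And>x y. G x \<bullet> y = x \<bullet> G y"
    and "subspace S"
  shows "\<exists>B l. span B = S \<and> diagonalizes G B l"
  using \<open>subspace S\<close>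
proof (induction "dim S" arbitrary: S rule: less_induct)
  case less
  note S = less.prems
  show ?case
  proof (cases "S = {0}")
    case True
    then show ?thesis
      by (intro exI[of _ "{}"]) (auto simp: diagonalizes_def orthonormal_def)
  next
    case False
    obtain e m where e: "e \<in> S" "norm e = 1" and el: "\<And>y. y \<in> S \<Longrightarrow> G e \<bullet> y = m * (e \<bullet> y)"
      using max_rayleigh_eigenvector[OF G sym S False] by metis
    define S' where "S' = {y \<in> S. y \<bullet> e = 0}"
    have S': "subspace S'"
      using S by (auto simp: S'_def subspace_def inner_add_left)
    have "e \<notin> S'"
      using e by (auto simp: S'_def dot_square_norm)
    then have "S' \<subset> S"
      using e(1) unfolding S'_def by blast
    then have "dim S' < dim S"
      using dim_psubset[of S' S] S S' by (simp add: span_eq_iff[THEN iffD2])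
    from less.hyps[OF this S'] obtain B l where B: "span B = S'" "diagonalizes G B l"
      by auto
    have perp: "b \<bullet> e = 0" if "b \<in> B" for b
      using that B(1) span_base[of b B] by (auto simp: S'_def)
    have "e \<notin> B"
      using \<open>e \<notin> S'\<close> B(1) span_base[of e B] by auto
    have sp: "span (insert e B) = S"
      using subspace_perp_insert[OF S e] B(1) by (simp add: S'_def)
    have "diagonalizes G (insert e B) (l(e := m))"
      unfolding diagonalizes_def sp
    proof (intro conjI ballI)
      show "orthonormal (insert e B)"
        using B(2) e perp by (intro orthonormal_insert) (auto simp: diagonalizes_def)
    next
      fix b y assume b: "b \<in> insert e B" and y: "y \<in> S"
      show "G b \<bullet> y = (l(e := m)) b * (b \<bullet> y)"
      proof (cases "b = e")
        case True
        then show ?thesis using el y by simp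
      next
        case False
        then have b: "b \<in> B" using b by simp
        then have "b \<in> S"
          using B(1) span_base[of b B] by (auto simp: S'_def)
        \<comment> \<open>By symmetry this is \<open>G e \<bullet> b = m * (e \<bullet> b)\<close>,
          which is zero by orthogonality. So the component of \<open>y\<close> along
          \<open>e\<close> contributes nothing on either side.\<close>
        have "G b \<bullet> e = 0"
          using el[OF \<open>b \<in> S\<close>] sym[of b e] perp[OF b] by (simp add: inner_commute)
        obtain c where c: "y - c *\<^sub>R e \<in> span B"
          using y sp by (auto simp: span_insert)
        have "G b \<bullet> (y - c *\<^sub>R e) = l b * (b \<bullet> (y - c *\<^sub>R e))"
          using B(2) b c by (auto simp: diagonalizes_def)
        then show ?thesis
          using False \<open>G b \<bullet> e = 0\<close> perp[OF b] by (simp add: inner_diff_right)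
      qed
    qed
    then show ?thesis using sp by blast
  qed
qed

subsection \<open>The barrier argument\<close>

text \<open>With \<phi> the sum of \<open>u\<close>, both
  \<open>v i = u i * \<phi> / (\<phi> - u i)\<close> and \<open>v i / u i\<close> increase with
  \<open>u i\<close>. Chebyshev's sum inequality for these two sequences with weights
  \<open>u i\<close> is the claim; here \<open>u\<close> and \<open>v\<close> stand for the
  resolvent eigenvalues before and after the barrier moves.\<close>

lemma chebyshev_trace_inequality:
  fixes u v :: "'i \<Rightarrow> real"
  assumes fin: "finite I" and ne: "I \<noteq> {}"
    and u: "\<And>i. i \<in> I \<Longrightarrow> 0 < u i" and lt: "\<And>i. i \<in> I \<Longrightarrow> u i < sum u I"
    and v: "\<And>i. i \<in> I \<Longrightarrow> v i = 1 / (1 / u i - 1 / sum u I)"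
  shows "(sum v I)\<^sup>2 - (\<Sum>i\<in>I. (v i)\<^sup>2) \<le> sum u I * sum v I"
proof -
  define \<phi> where "\<phi> = sum u I"
  have \<phi>: "\<phi> > 0" unfolding \<phi>_def using fin ne u by (rule sum_pos)
  have v': "v i = u i * \<phi> / (\<phi> - u i)" if "i \<in> I" for i
    using v[OF that] u[OF that] lt[OF that] \<phi> by (auto simp: \<phi>_def[symmetric] divide_simps)
  \<comment> \<open>The resolvent identity: the reciprocals of \<open>u i\<close> and
    \<open>v i\<close> differ by \<open>1 / \<phi>\<close>. It later eliminates the mixed sum of
    \<open>u i * v i\<close>.\<close>
  have rel: "\<phi> * (v i - u i) = u i * v i" if "i \<in> I" for i
    using v'[OF that] lt[OF that] by (simp add: \<phi>_def[symmetric] field_simps)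
  have "0 \<le> (\<Sum>i\<in>I. \<Sum>j\<in>I. (v i - v j) * (v i * u j - v j * u i))"
  proof (intro sum_nonneg)
    fix i j assume i: "i \<in> I" and j: "j \<in> I"
    have d: "\<phi> - u i \<noteq> 0" "\<phi> - u j \<noteq> 0"
      using lt[OF i] lt[OF j] by (auto simp: \<phi>_def)
    have "v i * u j - v j * u i = u i * u j * \<phi> * (u i - u j) / ((\<phi> - u i) * (\<phi> - u j))"
      unfolding v'[OF i] v'[OF j] using d by (simp add: field_simps)
    moreover have "v i - v j = \<phi> * \<phi> * (u i - u j) / ((\<phi> - u i) * (\<phi> - u j))"
      unfolding v'[OF i] v'[OF j] using d by (simp add: field_simps)
    ultimately have "(v i - v j) * (v i * u j - v j * u i) =
        u i * u j * \<phi> * \<phi> * \<phi> * (u i - u j)\<^sup>2 / ((\<phi> - u i) * (\<phi> - u j))\<^sup>2"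
      by (simp add: power2_eq_square)
    also have "\<dots> \<ge> 0"
      using u[OF i] u[OF j] \<phi> by simp
    finally show "0 \<le> (v i - v j) * (v i * u j - v j * u i)" .
  qed
  also have "\<dots> = (\<Sum>i\<in>I. \<Sum>j\<in>I. (v i)\<^sup>2 * u j + u i * (v j)\<^sup>2 - v i * (u j * v j) - (u i * v i) * v j)"
    by (simp add: power2_eq_square algebra_simps)
  also have "\<dots> = (\<Sum>i\<in>I. (v i)\<^sup>2) * sum u I + sum u I * (\<Sum>i\<in>I. (v i)\<^sup>2)
      - sum v I * (\<Sum>i\<in>I. u i * v i) - (\<Sum>i\<in>I. u i * v i) * sum v I"
    unfolding sum_product sum_subtractf sum.distrib ..
  also have "\<dots> = 2 * (sum u I * (\<Sum>i\<in>I. (v i)\<^sup>2) - sum v I * (\<Sum>i\<in>I. u i * v i))"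
    by (simp add: algebra_simps)
  also have "(\<Sum>i\<in>I. u i * v i) = \<phi> * (sum v I - sum u I)"
    by (simp add: rel[symmetric] sum_distrib_left[symmetric] sum_subtractf)
  finally have "0 \<le> (2 * \<phi>) * ((\<Sum>i\<in>I. (v i)\<^sup>2) - sum v I * (sum v I - sum u I))"
    by (simp add: \<phi>_def algebra_simps)
  then have "0 \<le> (\<Sum>i\<in>I. (v i)\<^sup>2) - sum v I * (sum v I - sum u I)"
    using \<phi> by (subst (asm) zero_le_mult_iff) linarith
  then show ?thesis
    by (simp add: power2_eq_square algebra_simps)
qed

section \<open>Resolvent traces of compressions and the removal of coordinates\<close>

lemma diagonalizes_inner_sum:
  assumes B: "diagonalizes G B l" and sym: "\<And>x y. G x \<bullet> y = x \<bullet> G y" and x: "x \<in> span B"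
  shows "G x \<bullet> x = (\<Sum>b\<in>B. l b * (b \<bullet> x)\<^sup>2)"
proof -
  have on: "orthonormal B"
    using B by (simp add: diagonalizes_def)
  have "x \<bullet> G x = (\<Sum>b\<in>B. (b \<bullet> x) * (b \<bullet> G x))"
    by (rule orthonormal_parseval[OF on x])
  also have "\<dots> = (\<Sum>b\<in>B. l b * (b \<bullet> x)\<^sup>2)"
    using B x by (intro sum.cong) (auto simp: diagonalizes_def sym[symmetric] power2_eq_square)
  finally show ?thesis
    by (simp add: inner_commute)
qed

text \<open>The number \<open>l' e\<close> equals \<open>G e \<bullet> e\<close>, which is an
  average of the \<open>l b\<close> with weights \<open>(b \<bullet> e)\<^sup>2\<close> summing to
  1. This is the elementary half of Cauchy interlacing.\<close>

lemma compression_eigenvalue_gt: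
  assumes B: "diagonalizes G B l" and sym: "\<And>x y. G x \<bullet> y = x \<bullet> G y"
    and B': "diagonalizes G B' l'" and sub: "span B' \<subseteq> span B"
    and c: "\<And>b. b \<in> B \<Longrightarrow> c < l b" and e: "e \<in> B'"
  shows "c < l' e"
proof -
  have on: "orthonormal B" "orthonormal B'"
    using B B' by (auto simp: diagonalizes_def)
  have eB: "e \<in> span B" "e \<in> span B'"
    using sub span_base[OF e] by auto
  have ee: "e \<bullet> e = 1"
    using orthonormal_inner[OF on(2) e e] by simp
  have one: "(\<Sum>b\<in>B. (b \<bullet> e)\<^sup>2) = 1"
    using orthonormal_parseval[OF on(1) eB(1), of e, symmetric] ee by (simp add: power2_eq_square)
  have e0: "e \<noteq> 0" using ee by auto
  obtain b where b: "b \<in> B" "b \<bullet> e \<noteq> 0"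
    using orthonormal_inner_nonzero[OF on(1) eB(1)] e0 by metis
  have "c = (\<Sum>b\<in>B. c * (b \<bullet> e)\<^sup>2)"
    using one by (simp add: sum_distrib_left[symmetric])
  also have "\<dots> < (\<Sum>b\<in>B. l b * (b \<bullet> e)\<^sup>2)"
  proof (rule sum_strict_mono_ex1)
    show "\<forall>b\<in>B. c * (b \<bullet> e)\<^sup>2 \<le> l b * (b \<bullet> e)\<^sup>2"
      using c by (simp add: mult_right_mono less_imp_le)
    show "\<exists>b\<in>B. c * (b \<bullet> e)\<^sup>2 < l b * (b \<bullet> e)\<^sup>2"
      using b c by (intro bexI[of _ b]) auto
  qed (rule orthonormal_finite[OF on(1)])
  also have "\<dots> = G e \<bullet> e"
    by (rule diagonalizes_inner_sum[OF B sym eB(1), symmetric])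
  also have "\<dots> = l' e"
    using B' e eB ee by (simp add: diagonalizes_def)
  finally show ?thesis .
qed

text \<open>This is the Schur complement formula for the inverse of a matrix with one row and column
  removed, after taking traces; \<open>n\<close> and \<open>w\<close> are the \<open>e\<close>-th diagonal entries of the inverse
  of \<open>G - c\<close> and of its square.\<close>

lemma compression_resolvent_trace:
  fixes G :: "'a::euclidean_space \<Rightarrow> 'a"
  assumes B: "diagonalizes G B l" and sym: "\<And>x y. G x \<bullet> y = x \<bullet> G y"
    and B': "diagonalizes G B' l'" and on': "orthonormal (insert e B')" and e: "e \<notin> B'"
    and sp: "span (insert e B') = span B"
    and c: "\<And>b. b \<in> B \<Longrightarrow> c < l b"
  defines "n \<equiv> (\<Sum>b\<in>B. (b \<bullet> e)\<^sup>2 / (l b - c))" and "w \<equiv> (\<Sum>b\<in>B. ((b \<bullet> e) / (l b - c))\<^sup>2)"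
  shows "n > 0" and "(\<Sum>b\<in>B'. 1 / (l' b - c)) = (\<Sum>b\<in>B. 1 / (l b - c)) - w / n"
proof -
  have on: "orthonormal B" and onB': "orthonormal B'"
    using B B' by (auto simp: diagonalizes_def)
  have fin: "finite B" "finite B'"
    using on onB' by (auto intro: orthonormal_finite)
  have eB: "e \<in> span B"
    using sp span_base[of e "insert e B'"] by simp
  have ee: "e \<bullet> e = 1"
    using orthonormal_inner[OF on', of e e] by simp
  have sub: "span B' \<subseteq> span B"
    using sp by (metis span_mono subset_insertI)
  have e0: "e \<noteq> 0" using ee by auto
  obtain b where b: "b \<in> B" "b \<bullet> e \<noteq> 0"
    using orthonormal_inner_nonzero[OF on eB] e0 by metis
  show n: "n > 0"
    unfolding n_def using c fin b
    by (intro sum_pos2[of _ b]) (auto simp: less_imp_le)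
  \<comment> \<open>Let \<open>N\<close> be the inverse of the compression of \<open>G - c\<close>
    to \<open>span B\<close>. Then \<open>\<nu> b\<close> are its eigenvalues, \<open>p x\<close> is
    its entry between \<open>x\<close> and \<open>e\<close>, and \<open>q x\<close> is its diagonal
    entry at \<open>x\<close>.\<close>
  define \<nu> where "\<nu> b = 1 / (l b - c)" for b
  define p where "p x = (\<Sum>b\<in>B. \<nu> b * (b \<bullet> x) * (b \<bullet> e))" for x
  define q where "q x = (\<Sum>b\<in>B. \<nu> b * (b \<bullet> x)\<^sup>2)" for x
  have gt: "c < l' x" if "x \<in> B'" for x
    using compression_eigenvalue_gt[OF B sym B' sub c that] .
  \<comment> \<open>Projected to \<open>span B\<close>, the vector \<open>(G - c) x\<close> is
    \<open>\<mu> x + s e\<close>, so \<open>x = N (\<mu> x + s e)\<close>; this is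
    \<open>coord\<close>. Pairing with \<open>e\<close>, which is orthogonal to \<open>x\<close>,
    determines \<open>s\<close>; pairing with the unit vector \<open>x\<close> then determines
    \<mu>.\<close>
  have recip: "1 / (l' x - c) = q x - (p x)\<^sup>2 / n" if x: "x \<in> B'" for x
  proof -
    define \<mu> where "\<mu> = l' x - c"
    have \<mu>: "\<mu> > 0" using gt[OF x] by (simp add: \<mu>_def)
    have xB: "x \<in> span B" using sub span_base[OF x] by auto
    have xx: "x \<bullet> x = 1" using orthonormal_inner[OF onB' x x] by simp
    have xe: "x \<bullet> e = 0" using orthonormal_inner[OF on', of x e] x e by auto
    define s where "s = G x \<bullet> e"
    have coord: "b \<bullet> x = \<nu> b * (\<mu> * (b \<bullet> x) + s * (b \<bullet> e))" if b: "b \<in> B" for b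
    proof -
      have "b \<in> span (insert e B')"
        using sp b span_base[of b B] by simp
      then obtain t where t: "b - t *\<^sub>R e \<in> span B'"
        by (auto simp: span_insert)
      have "(b - t *\<^sub>R e) \<bullet> e = 0"
        using t by (rule span_induct)
          (use orthonormal_inner[OF on'] e in \<open>auto simp: subspace_def inner_add_left\<close>)
      then have t_eq: "t = b \<bullet> e"
        using ee by (simp add: inner_diff_left)
      have "G x \<bullet> (b - t *\<^sub>R e) = l' x * (x \<bullet> (b - t *\<^sub>R e))"
        using B' x t by (simp add: diagonalizes_def)
      then have "G x \<bullet> b = l' x * (b \<bullet> x) + s * (b \<bullet> e)"
        using xe by (simp add: inner_diff_right t_eq s_def inner_commute algebra_simps)
      moreover have "G x \<bullet> b = l b * (b \<bullet> x)"
        using B b xB sym[of x b] by (auto simp: diagonalizes_def inner_commute)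
      ultimately have "(l b - c) * (b \<bullet> x) = \<mu> * (b \<bullet> x) + s * (b \<bullet> e)"
        by (simp add: \<mu>_def algebra_simps)
      then show ?thesis
        using c[OF b] by (simp add: \<nu>_def field_simps)
    qed
    have "0 = (\<Sum>b\<in>B. (b \<bullet> x) * (b \<bullet> e))"
      using orthonormal_parseval[OF on xB, of e] xe by simp
    also have "\<dots> = (\<Sum>b\<in>B. \<nu> b * (\<mu> * (b \<bullet> x) + s * (b \<bullet> e)) * (b \<bullet> e))"
      using coord by (intro sum.cong refl arg_cong2[where f = "(*)"])
    also have "\<dots> = \<mu> * p x + s * n"
      by (simp add: p_def n_def \<nu>_def sum_distrib_left sum.distrib[symmetric]
          power2_eq_square algebra_simps add_divide_distrib)
    finally have s: "s = - \<mu> * p x / n"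
      using n by (simp add: field_simps)
    have "1 = (\<Sum>b\<in>B. (b \<bullet> x) * (b \<bullet> x))"
      using orthonormal_parseval[OF on xB, of x] xx by simp
    also have "\<dots> = (\<Sum>b\<in>B. \<nu> b * (\<mu> * (b \<bullet> x) + s * (b \<bullet> e)) * (b \<bullet> x))"
      using coord by (intro sum.cong refl arg_cong2[where f = "(*)"])
    also have "\<dots> = \<mu> * q x + s * p x"
      by (simp add: p_def q_def sum_distrib_left sum.distrib[symmetric]
          power2_eq_square algebra_simps)
    also have "\<dots> = \<mu> * (q x - (p x)\<^sup>2 / n)"
      by (simp add: s power2_eq_square algebra_simps)
    finally show ?thesis
      using \<mu> by (simp add: \<mu>_def[symmetric] field_simps)
  qed
  have rest: "(\<Sum>x\<in>B'. (x \<bullet> y)\<^sup>2) = y \<bullet> y - (e \<bullet> y)\<^sup>2" if "y \<in> span B" for y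
  proof -
    have "y \<bullet> y = (\<Sum>b\<in>insert e B'. (b \<bullet> y) * (b \<bullet> y))"
      using that sp by (intro orthonormal_parseval[OF on']) simp
    then show ?thesis
      using fin e by (simp add: power2_eq_square)
  qed
  have "(\<Sum>x\<in>B'. q x) = (\<Sum>b\<in>B. \<nu> b * (\<Sum>x\<in>B'. (x \<bullet> b)\<^sup>2))"
    unfolding q_def sum_distrib_left by (subst sum.swap) (simp add: inner_commute)
  also have "\<dots> = (\<Sum>b\<in>B. \<nu> b * (1 - (b \<bullet> e)\<^sup>2))"
    using rest orthonormal_inner[OF on]
    by (intro sum.cong) (auto simp: span_base inner_commute)
  also have "\<dots> = sum \<nu> B - n"
    by (simp add: n_def \<nu>_def sum_subtractf right_diff_distrib)
  finally have q: "(\<Sum>x\<in>B'. q x) = sum \<nu> B - n" .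
  \<comment> \<open>This is \<open>N e\<close>, so that \<open>w\<close>, \<open>n\<close> and
    \<open>p x\<close> become its inner products with itself, with \<open>e\<close> and with
    \<open>x\<close>.\<close>
  define f where "f = (\<Sum>b\<in>B. (\<nu> b * (b \<bullet> e)) *\<^sub>R b)"
  have fB: "f \<in> span B"
    unfolding f_def by (intro span_sum span_scale span_base)
  have bf: "b \<bullet> f = \<nu> b * (b \<bullet> e)" if "b \<in> B" for b
    unfolding f_def by (rule orthonormal_inner_sum[OF on that])
  have "f \<bullet> f = (\<Sum>b\<in>B. (b \<bullet> f) * (b \<bullet> f))"
    by (rule orthonormal_parseval[OF on fB])
  also have "\<dots> = w"
    unfolding w_def by (intro sum.cong) (auto simp: bf \<nu>_def power2_eq_square)
  finally have ff: "f \<bullet> f = w" .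
  have fe: "e \<bullet> f = n"
    by (simp add: f_def n_def \<nu>_def inner_sum_right power2_eq_square inner_commute)
  have pf: "p x = x \<bullet> f" for x
    by (simp add: f_def p_def inner_sum_right inner_commute mult_ac)
  have "(\<Sum>x\<in>B'. (p x)\<^sup>2) = w - n\<^sup>2"
    using rest[OF fB] by (simp add: pf ff fe)
  then have "(\<Sum>x\<in>B'. 1 / (l' x - c)) = sum \<nu> B - n - (w - n\<^sup>2) / n"
    by (simp add: recip sum_subtractf q sum_divide_distrib[symmetric])
  also have "\<dots> = sum \<nu> B - w / n"
    using n by (simp add: field_simps power2_eq_square)
  finally show "(\<Sum>b\<in>B'. 1 / (l' b - c)) = (\<Sum>b\<in>B. 1 / (l b - c)) - w / n"
    by (simp add: \<nu>_def)
qed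

text \<open>Raising the barrier turns the resolvent trace \<phi> into \<open>sum v B\<close>, and
  removing \<open>e\<close> lowers it by \<open>w e / n e\<close>. By Chebyshev's inequality the
  average of the loss with weights \<open>n e\<close> makes up for the raise, so some single
  \<open>e\<close> does.\<close>

lemma barrier_step:
  fixes G :: "'a::euclidean_space \<Rightarrow> 'a"
  assumes G: "linear G" and sym: "\<And>x y. G x \<bullet> y = x \<bullet> G y"
    and B: "diagonalizes G B l" and E: "orthonormal E" "span E = span B" "card E \<ge> 2"
    and c: "\<And>b. b \<in> B \<Longrightarrow> c < l b"
  defines "\<phi> \<equiv> (\<Sum>b\<in>B. 1 / (l b - c))"
  obtains e B' l' where "e \<in> E" "span B' = span (E - {e})" "diagonalizes G B' l'"
    "\<And>b. b \<in> B' \<Longrightarrow> c + 1 / \<phi> < l' b"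
    "(\<Sum>b\<in>B'. 1 / (l' b - (c + 1 / \<phi>))) \<le> \<phi>"
proof -
  have on: "orthonormal B"
    using B by (auto simp: diagonalizes_def)
  have fin: "finite B" "finite E"
    using on E by (auto intro: orthonormal_finite)
  have cardB: "card B \<ge> 2"
    using E on by (simp add: orthonormal_card)
  then have ne: "B \<noteq> {}" by auto
  define u where "u b = 1 / (l b - c)" for b
  have u: "u b > 0" if "b \<in> B" for b
    using c[OF that] by (simp add: u_def)
  have \<phi>u: "\<phi> = sum u B"
    by (simp add: \<phi>_def u_def)
  have \<phi>: "\<phi> > 0"
    unfolding \<phi>u using fin(1) ne u by (rule sum_pos)
  \<comment> \<open>A second basis vector makes this strict; therefore the raised barrier stays
    strictly below every eigenvalue.\<close>
  have lt: "u b < sum u B" if b: "b \<in> B" for b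
  proof -
    obtain d where d: "d \<in> B" "d \<noteq> b"
      using cardB b by (metis card_le_Suc0_iff_eq fin(1) not_less_eq_eq numeral_2_eq_2)
    have "u b < u b + u d" using u d by simp
    also have "\<dots> = sum u {b, d}" using d by simp
    also have "\<dots> \<le> sum u B"
      using b d u fin by (intro sum_mono2) (auto simp: less_imp_le)
    finally show ?thesis .
  qed
  define c' where "c' = c + 1 / \<phi>"
  have c': "c' < l b" if "b \<in> B" for b
  proof -
    have "1 / (l b - c) < \<phi>"
      using lt[OF that] unfolding \<phi>u[symmetric] u_def .
    then show ?thesis
      using c[OF that] \<phi> by (simp add: c'_def field_simps)
  qed
  define v where "v b = 1 / (l b - c')" for b
  have cheb: "(sum v B)\<^sup>2 - (\<Sum>b\<in>B. (v b)\<^sup>2) \<le> \<phi> * sum v B"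
    unfolding \<phi>u using fin(1) ne u lt
  proof (rule chebyshev_trace_inequality)
    show "v b = 1 / (1 / u b - 1 / sum u B)" for b
      unfolding v_def c'_def \<phi>u by (simp add: u_def)
  qed
  define n where "n e = (\<Sum>b\<in>B. (b \<bullet> e)\<^sup>2 / (l b - c'))" for e
  define w where "w e = (\<Sum>b\<in>B. ((b \<bullet> e) / (l b - c'))\<^sup>2)" for e
  \<comment> \<open>Consequently the traces of the resolvent and of its square can be computed in
    \<open>E\<close> as well as in the eigenbasis \<open>B\<close>.\<close>
  have unit: "(\<Sum>e\<in>E. (b \<bullet> e)\<^sup>2) = 1" if b: "b \<in> B" for b
  proof -
    have "b \<in> span E"
      using b E(2) by (simp add: span_base)
    from orthonormal_parseval[OF E(1) this, of b, symmetric] show ?thesis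
      using orthonormal_inner[OF on b b] by (simp add: power2_eq_square inner_commute)
  qed
  have "sum n E = (\<Sum>b\<in>B. (\<Sum>e\<in>E. (b \<bullet> e)\<^sup>2) / (l b - c'))"
    unfolding n_def by (subst sum.swap) (simp add: sum_divide_distrib)
  then have n_sum: "sum n E = sum v B"
    by (simp add: unit v_def)
  have "sum w E = (\<Sum>b\<in>B. (\<Sum>e\<in>E. (b \<bullet> e)\<^sup>2) / (l b - c')\<^sup>2)"
    unfolding w_def by (subst sum.swap) (simp add: sum_divide_distrib power_divide)
  then have w_sum: "sum w E = (\<Sum>b\<in>B. (v b)\<^sup>2)"
    by (simp add: unit v_def power_divide)
  \<comment> \<open>Summed over \<open>E\<close>, the two sides become the two sides of
    \<open>cheb\<close>, so the inequality cannot fail for every \<open>e\<close>. Dividing by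
    \<open>n e\<close> turns it into the trace bound.\<close>
  have "\<exists>e\<in>E. n e * sum v B - w e \<le> \<phi> * n e"
  proof (rule ccontr)
    assume "\<not> ?thesis"
    then have less: "\<phi> * n e < n e * sum v B - w e" if "e \<in> E" for e
      using that by force
    have "E \<noteq> {}" using E by auto
    have "(\<Sum>e\<in>E. \<phi> * n e) < (\<Sum>e\<in>E. n e * sum v B - w e)"
      using fin(2) \<open>E \<noteq> {}\<close> less by (rule sum_strict_mono)
    also have "\<dots> = (sum v B)\<^sup>2 - (\<Sum>b\<in>B. (v b)\<^sup>2)"
      by (simp add: sum_subtractf sum_distrib_right[symmetric] n_sum w_sum power2_eq_square)
    finally show False
      using cheb by (simp add: sum_distrib_left[symmetric] n_sum)
  qed
  then obtain e where e: "e \<in> E" and le: "n e * sum v B - w e \<le> \<phi> * n e"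
    by blast
  obtain B' l' where B': "span B' = span (E - {e})" "diagonalizes G B' l'"
    using exists_diagonalizes[OF G sym subspace_span] by metis
  have perp: "b \<bullet> e = 0" if "b \<in> B'" for b
  proof -
    have "b \<in> span (E - {e})"
      using B'(1) that span_base by blast
    then show ?thesis
      by (rule span_induct)
        (use orthonormal_inner[OF E(1)] e in \<open>auto simp: subspace_def inner_add_left\<close>)
  qed
  have ee: "e \<bullet> e = 1" "norm e = 1"
    using orthonormal_inner[OF E(1) e e] E e by (auto simp: orthonormal_def)
  have "e \<notin> B'"
    using perp[of e] ee by auto
  have on': "orthonormal (insert e B')"
    using B' perp ee by (intro orthonormal_insert) (auto simp: diagonalizes_def)
  have "span (insert e B') = span (insert e (E - {e}))"
    by (simp only: span_insert B'(1))
  then have sp: "span (insert e B') = span B"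
    using E(2) e by (simp add: insert_absorb)
  have sub: "span B' \<subseteq> span B"
    using sp by (metis span_mono subset_insertI)
  note tr = compression_resolvent_trace[OF B sym B'(2) on' \<open>e \<notin> B'\<close> sp c', folded n_def w_def]
  have "(\<Sum>b\<in>B'. 1 / (l' b - c')) = sum v B - w e / n e"
    using tr(2) by (simp add: v_def)
  also have "\<dots> \<le> \<phi>"
    using le tr(1) by (simp add: field_simps)
  finally show thesis
    using that[OF e B'] compression_eigenvalue_gt[OF B sym B'(2) sub c'] unfolding c'_def by blast
qed

text \<open>The actual trace \<psi> never exceeds \<phi>, so a step of length
  \<open>1 / \<psi>\<close> is at least \<open>1 / \<phi>\<close>. Using only the shorter step
  lowers the barrier, which can only decrease the trace, and gives the same increment every
  time.\<close>

lemma barrier_iterate: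
  fixes G :: "'a::euclidean_space \<Rightarrow> 'a"
  assumes G: "linear G" and sym: "\<And>x y. G x \<bullet> y = x \<bullet> G y"
    and "diagonalizes G B l" and "orthonormal E" "span E = span B" "card E = k + j" and k: "k \<ge> 1"
    and "\<And>b. b \<in> B \<Longrightarrow> c < l b" and "(\<Sum>b\<in>B. 1 / (l b - c)) \<le> \<phi>"
  shows "\<exists>F\<subseteq>E. card F = k \<and> (\<forall>x\<in>span F. (c + real j / \<phi>) * (norm x)\<^sup>2 \<le> G x \<bullet> x)"
  using assms(3-6,8,9)
proof (induction j arbitrary: B l E c)
  case 0
  have on: "orthonormal B"
    using 0(1) by (simp add: diagonalizes_def)
  have "c * (norm x)\<^sup>2 \<le> G x \<bullet> x" if "x \<in> span E" for x
  proof -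
    have x: "x \<in> span B" using that 0 by simp
    have "c * (norm x)\<^sup>2 = (\<Sum>b\<in>B. c * (b \<bullet> x)\<^sup>2)"
      using orthonormal_parseval_square[OF on x] by (simp add: sum_distrib_left)
    also have "\<dots> \<le> (\<Sum>b\<in>B. l b * (b \<bullet> x)\<^sup>2)"
      using 0(5) by (intro sum_mono mult_right_mono) (auto simp: less_imp_le)
    also have "\<dots> = G x \<bullet> x"
      by (rule diagonalizes_inner_sum[OF 0(1) sym x, symmetric])
    finally show ?thesis .
  qed
  then show ?case
    using 0 by (intro exI[of _ E]) auto
next
  case (Suc j)
  define \<psi> where "\<psi> = (\<Sum>b\<in>B. 1 / (l b - c))"
  \<comment> \<open>At least one vector is kept and one removal is still due, so two vectors are
    present, as \<open>barrier_step\<close> demands.\<close>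
  have "card E \<ge> 2" using Suc.prems(4) k by simp
  then obtain e B' l' where e: "e \<in> E" and B': "span B' = span (E - {e})" "diagonalizes G B' l'"
    and gt: "\<And>b. b \<in> B' \<Longrightarrow> c + 1 / \<psi> < l' b"
    and tr: "(\<Sum>b\<in>B'. 1 / (l' b - (c + 1 / \<psi>))) \<le> \<psi>"
    using barrier_step[OF G sym Suc.prems(1-3) _ Suc.prems(5)] unfolding \<psi>_def by metis
  have on: "orthonormal B"
    using Suc.prems(1) by (simp add: diagonalizes_def)
  have "card B \<ge> 2"
    using Suc.prems(2,3) \<open>card E \<ge> 2\<close> on by (simp add: orthonormal_card)
  then have "\<psi> > 0"
    unfolding \<psi>_def using Suc.prems(5) orthonormal_finite[OF on] by (intro sum_pos) auto
  have \<psi>: "\<psi> \<le> \<phi>"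
    using Suc.prems(6) by (simp add: \<psi>_def)
  have gt': "c + 1 / \<phi> < l' b" if "b \<in> B'" for b
    using gt[OF that] frac_le[of 1 1 \<psi> \<phi>] \<open>\<psi> > 0\<close> \<psi> by simp
  have "(\<Sum>b\<in>B'. 1 / (l' b - (c + 1 / \<phi>))) \<le> (\<Sum>b\<in>B'. 1 / (l' b - (c + 1 / \<psi>)))"
    using gt gt' frac_le[of 1 1 \<psi> \<phi>] \<open>\<psi> > 0\<close> \<psi> by (intro sum_mono frac_le) auto
  then have tr': "(\<Sum>b\<in>B'. 1 / (l' b - (c + 1 / \<phi>))) \<le> \<phi>"
    using tr \<psi> by simp
  have "card (E - {e}) = k + j"
    using Suc.prems(4) e by simp
  moreover have "orthonormal (E - {e})"
    using Suc.prems(2) by (rule orthonormal_subset) auto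
  ultimately obtain F where F: "F \<subseteq> E - {e}" "card F = k"
    "\<forall>x\<in>span F. (c + 1 / \<phi> + real j / \<phi>) * (norm x)\<^sup>2 \<le> G x \<bullet> x"
    using Suc.IH[OF B'(2) _ B'(1)[symmetric] _ gt' tr'] by auto
  then show ?case
    by (intro exI[of _ F]) (auto simp: add_divide_distrib add_ac)
qed

subsection \<open>Singular values\<close>

lemma diagonalizes_eigenvector:
  assumes "diagonalizes G B l" "span B = UNIV" "b \<in> B"
  shows "G b = l b *\<^sub>R b"
proof -
  have "G b \<bullet> y = (l b *\<^sub>R b) \<bullet> y" for y
    using assms by (simp add: diagonalizes_def)
  then show ?thesis
    using vector_eq_rdot by blast
qed

lemma linear_eq_on_orthonormal_basis:
  assumes "linear f" "linear g" "span B = UNIV" "\<And>b. b \<in> B \<Longrightarrow> f b = g b"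
  shows "f = g"
proof
  fix x
  show "f x = g x"
    using linear_eq_on_span[OF assms(1,2,4), of B x] assms(3) by simp
qed

lemma linear_diagonal:
  fixes B :: "'a::real_inner set"
  shows "linear (\<lambda>x. \<Sum>b\<in>B. (f b * (b \<bullet> x)) *\<^sub>R b)"
  by (intro linearI) (simp_all add: inner_add_right algebra_simps sum.distrib scaleR_sum_right)

lemma diagonal_basis_vector:
  assumes "orthonormal B" "b \<in> B"
  shows "(\<Sum>a\<in>B. (f a * (a \<bullet> b)) *\<^sub>R a) = f b *\<^sub>R b"
proof -
  have "(\<Sum>a\<in>B. (f a * (a \<bullet> b)) *\<^sub>R a) = (\<Sum>a\<in>B. if a = b then f b *\<^sub>R b else 0)"
    using assms by (intro sum.cong) (auto simp: orthonormal_inner)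
  then show ?thesis
    using orthonormal_finite[OF assms(1)] assms(2) by simp
qed

text \<open>The diagonal operator is a positive root; the definite description also asks for
  uniqueness. If \<open>C\<close> is a positive root and \<open>s = sqrt (l b)\<close>, then
  \<open>v = C b - s *\<^sub>R b\<close> satisfies \<open>C v = - s *\<^sub>R v\<close>, which
  positivity forbids for \<open>s > 0\<close> unless \<open>v = 0\<close>. For \<open>s = 0\<close>,
  symmetry gives \<open>C b \<bullet> C b = b \<bullet> C (C b) = 0\<close>.\<close>

lemma operator_sqrt_eq:
  fixes G :: "'a::euclidean_space \<Rightarrow> 'a"
  assumes G: "linear G" and B: "diagonalizes G B l" and sp: "span B = UNIV"
    and nonneg: "\<And>b. b \<in> B \<Longrightarrow> l b \<ge> 0"
  shows "operator_sqrt G = (\<lambda>x. \<Sum>b\<in>B. (sqrt (l b) * (b \<bullet> x)) *\<^sub>R b)"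
proof -
  have on: "orthonormal B"
    using B by (simp add: diagonalizes_def)
  define R where "R x = (\<Sum>b\<in>B. (sqrt (l b) * (b \<bullet> x)) *\<^sub>R b)" for x
  have linR: "linear R"
    unfolding R_def by (rule linear_diagonal)
  have Rb: "R b = sqrt (l b) *\<^sub>R b" if "b \<in> B" for b
    unfolding R_def by (rule diagonal_basis_vector[OF on that])
  have R_inner: "R x \<bullet> y = (\<Sum>b\<in>B. sqrt (l b) * (b \<bullet> x) * (b \<bullet> y))" for x y
    by (simp add: R_def inner_sum_left)
  have "positive_operator R"
    unfolding positive_operator_def
  proof (intro conjI allI)
    show "R x \<bullet> y = x \<bullet> R y" for x y
      by (subst inner_commute[of x]) (simp add: R_inner mult_ac)
    show "0 \<le> R x \<bullet> x" for x
      unfolding R_inner using nonneg by (intro sum_nonneg) (simp add: mult.assoc)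
  qed (rule linR)
  moreover have "R \<circ> R = G"
    using linear_compose[OF linR linR] G sp
  proof (rule linear_eq_on_orthonormal_basis)
    show "(R \<circ> R) b = G b" if "b \<in> B" for b
      using nonneg[OF that]
      by (simp add: Rb[OF that] linear_scale[OF linR] diagonalizes_eigenvector[OF B sp that])
  qed
  moreover have "C = R" if C: "positive_operator C" "C \<circ> C = G" for C
  proof (rule linear_eq_on_orthonormal_basis[OF _ linR sp])
    show linC: "linear C"
      using C by (simp add: positive_operator_def)
    fix b assume b: "b \<in> B"
    define s where "s = sqrt (l b)"
    define v where "v = C b - s *\<^sub>R b"
    have s: "s \<ge> 0" "s * s = l b"
      using nonneg[OF b] by (simp_all add: s_def)
    have CC: "C (C b) = (s * s) *\<^sub>R b"
      using C(2) diagonalizes_eigenvector[OF B sp b] s by (metis comp_apply)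
    then have Cv: "C v = - s *\<^sub>R v"
      by (simp add: v_def linear_diff[OF linC] linear_scale[OF linC] algebra_simps)
    have "v = 0"
    proof (cases "s = 0")
      case True
      have "v \<bullet> v = C b \<bullet> C b"
        using True by (simp add: v_def)
      also have "\<dots> = b \<bullet> C (C b)"
        using C by (simp add: positive_operator_def)
      finally show ?thesis
        using True CC by simp
    next
      case False
      have "0 \<le> C v \<bullet> v"
        using C(1) unfolding positive_operator_def by blast
      then have "s * (v \<bullet> v) \<le> 0"
        by (simp add: Cv)
      then show ?thesis
        using False s inner_ge_zero[of v] by (auto simp: mult_le_0_iff)
    qed
    then show "C b = R b"
      by (simp add: v_def Rb[OF b] s_def)
  qed
  ultimately have "operator_sqrt G = R"
    unfolding operator_sqrt_def by (intro the_equality conjI) (blast+)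
  then show ?thesis
    by (simp add: R_def fun_eq_iff)
qed

text \<open>Pairing \<open>R v = c *\<^sub>R v\<close> with \<open>b\<close> gives
  \<open>(m b - c) * (b \<bullet> v) = 0\<close>. So an eigenvector for \<open>c\<close> is a
  combination of those \<open>b\<close> with \<open>m b = c\<close>, and these form a basis of the
  eigenspace.\<close>

lemma eigenvalue_mset_eq:
  fixes R :: "'a::euclidean_space \<Rightarrow> 'a"
  assumes R: "linear R" and on: "orthonormal B" and sp: "span B = UNIV"
    and Rb: "\<And>b. b \<in> B \<Longrightarrow> R b = m b *\<^sub>R b"
  shows "eigenvalue_mset R = image_mset m (mset_set B)"
proof -
  note fin = orthonormal_finite[OF on]
  have coord: "(m b - c) * (b \<bullet> v) = 0" if v: "R v = c *\<^sub>R v" and b: "b \<in> B" for b v c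
  proof -
    have "R v = R (\<Sum>a\<in>B. (a \<bullet> v) *\<^sub>R a)"
      using orthonormal_expand[OF on, of v] sp by simp
    also have "\<dots> = (\<Sum>a\<in>B. ((a \<bullet> v) * m a) *\<^sub>R a)"
      by (simp add: linear_sum[OF R] linear_scale[OF R] Rb)
    finally have "b \<bullet> R v = (b \<bullet> v) * m b"
      using orthonormal_inner_sum[OF on b] by simp
    then show ?thesis
      by (auto simp: v)
  qed
  have ev: "eigenvalues R = m ` B"
  proof
    show "eigenvalues R \<subseteq> m ` B"
    proof
      fix c assume "c \<in> eigenvalues R"
      then obtain v where v: "v \<noteq> 0" "R v = c *\<^sub>R v"
        by (auto simp: eigenvalues_def)
      obtain b where "b \<in> B" "b \<bullet> v \<noteq> 0"
        using orthonormal_inner_nonzero[OF on _ v(1)] sp by auto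
      then show "c \<in> m ` B"
        using coord[OF v(2)] by force
    qed
    show "m ` B \<subseteq> eigenvalues R"
    proof
      fix c assume "c \<in> m ` B"
      then obtain b where "b \<in> B" "c = m b" by blast
      moreover from this have "b \<noteq> 0"
        using on by (auto simp: orthonormal_def)
      ultimately show "c \<in> eigenvalues R"
        using Rb by (auto simp: eigenvalues_def)
    qed
  qed
  have es: "dim (eigenspace R c) = card {b \<in> B. m b = c}" for c
  proof -
    have "eigenspace R c = span {b \<in> B. m b = c}"
    proof
      have "subspace (eigenspace R c)"
        by (auto simp: eigenspace_def subspace_def linear_0[OF R] linear_add[OF R]
            linear_scale[OF R] scaleR_add_right)
      then show "span {b \<in> B. m b = c} \<subseteq> eigenspace R c"
        using Rb by (intro span_minimal) (auto simp: eigenspace_def)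
      show "eigenspace R c \<subseteq> span {b \<in> B. m b = c}"
      proof
        fix v assume "v \<in> eigenspace R c"
        then have v: "R v = c *\<^sub>R v" by (simp add: eigenspace_def)
        have "v = (\<Sum>b\<in>B. (b \<bullet> v) *\<^sub>R b)"
          using sp by (intro orthonormal_expand[OF on]) simp
        also have "\<dots> = (\<Sum>b | b \<in> B \<and> m b = c. (b \<bullet> v) *\<^sub>R b)"
          using fin coord[OF v] by (intro sum.mono_neutral_right) auto
        also have "\<dots> \<in> span {b \<in> B. m b = c}"
          by (intro span_sum span_scale span_base) auto
        finally show "v \<in> span {b \<in> B. m b = c}" .
      qed
    qed
    moreover have "orthonormal {b \<in> B. m b = c}"
      using on by (rule orthonormal_subset) auto
    ultimately show ?thesis
      by (metis orthonormal_card dim_span)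
  qed
  show ?thesis
  proof (rule multiset_eqI)
    fix x
    have "count (eigenvalue_mset R) x = (\<Sum>c\<in>m ` B. if c = x then card {b \<in> B. m b = c} else 0)"
      unfolding eigenvalue_mset_def ev es count_sum by (intro sum.cong) auto
    also have "\<dots> = card {b \<in> B. m b = x}"
      using fin by (auto simp: sum.delta card_eq_0_iff)
    also have "\<dots> = count (image_mset m (mset_set B)) x"
    proof -
      have "{b \<in> B. m b = x} = {b. b \<in># mset_set B \<and> x = m b}"
        using fin by auto
      then show ?thesis
        using fin by (simp add: count_image_mset')
    qed
    finally show "count (eigenvalue_mset R) x = count (image_mset m (mset_set B)) x" .
  qed
qed

text \<open>In a decreasing list of nonnegative numbers the zeros come last, and they add nothing to
  the sum since \<open>f 0 = 0\<close>. This serves to cut the list of singular values at the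
  rank.\<close>

lemma sum_nth_antimono_prefix:
  fixes xs :: "real list" and f :: "real \<Rightarrow> real"
  assumes "sorted_wrt (\<ge>) xs" "\<And>x. x \<in> set xs \<Longrightarrow> x \<ge> 0" "f 0 = 0"
  shows "(\<Sum>i<length (filter (\<lambda>x. x \<noteq> 0) xs). f (xs ! i)) = sum_list (map f xs)"
  using assms(1,2)
proof (induction xs)
  case (Cons x xs)
  show ?case
  proof (cases "x = 0")
    case True
    then have zero: "\<forall>y\<in>set xs. y = 0"
      using Cons.prems by force
    then have "sum_list (map f xs) = 0"
      using assms(3) by (induction xs) auto
    moreover have "filter (\<lambda>x. x \<noteq> 0) xs = []"
      using zero by (simp add: filter_empty_conv)
    ultimately show ?thesis
      using True assms(3) by simp
  next
    case False
    then show ?thesis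
      using Cons by (simp add: sum.lessThan_Suc_shift del: sum.lessThan_Suc)
  qed
qed simp

section \<open>The Gram operator and its spectrum\<close>

lemma linear_gram:
  fixes A :: "'a::euclidean_space \<Rightarrow> 'b::euclidean_space"
  shows "linear A \<Longrightarrow> linear (adjoint A \<circ> A)"
  by (intro linear_compose adjoint_linear)

lemma inner_gram:
  fixes A :: "'a::euclidean_space \<Rightarrow> 'b::euclidean_space"
  shows "linear A \<Longrightarrow> (adjoint A \<circ> A) x \<bullet> y = A x \<bullet> A y"
  using adjoint_works[of A y "A x"] by (simp add: inner_commute)

lemma gram_selfadjoint:
  fixes A :: "'a::euclidean_space \<Rightarrow> 'b::euclidean_space"
  shows "linear A \<Longrightarrow> (adjoint A \<circ> A) x \<bullet> y = x \<bullet> (adjoint A \<circ> A) y"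
  by (metis inner_gram inner_commute)

text \<open>The zero eigenvalues do not contribute to \<open>\<Sum>b\<in>B. 1 / l b\<close>, because \<open>1 / 0 = 0\<close>.\<close>

lemma gram_spectrum:
  fixes A :: "'a::euclidean_space \<Rightarrow> 'b::euclidean_space"
  assumes A: "linear A"
  obtains B l where "diagonalizes (adjoint A \<circ> A) B l" "span B = UNIV"
    "\<And>b. b \<in> B \<Longrightarrow> l b \<ge> 0" "dim (range A) = card {b \<in> B. l b \<noteq> 0}"
    "(\<Sum>i = 1..dim (range A). 1 / (singular_value A i)\<^sup>2) = (\<Sum>b\<in>B. 1 / l b)"
proof -
  define G where "G = adjoint A \<circ> A"
  note G = linear_gram[OF A, folded G_def]
  note GA = inner_gram[OF A, folded G_def]
  note sym = gram_selfadjoint[OF A, folded G_def]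
  obtain B l where sp: "span B = UNIV" and B: "diagonalizes G B l"
    using exists_diagonalizes[OF G sym subspace_UNIV] by metis
  have on: "orthonormal B"
    using B by (simp add: diagonalizes_def)
  note fin = orthonormal_finite[OF on]
  \<comment> \<open>The images of the eigenvectors are orthogonal with squared lengths
    \<open>l b\<close>. The nonzero ones thus form a basis of the range, and the rank counts the
    nonzero eigenvalues.\<close>
  have AA: "A b \<bullet> A c = (if b = c then l b else 0)" if "b \<in> B" "c \<in> B" for b c
    using that B sp GA[of b c] orthonormal_inner[OF on] by (auto simp: diagonalizes_def)
  have nonneg: "l b \<ge> 0" if "b \<in> B" for b
    using AA[OF that that] inner_ge_zero[of "A b"] by simp
  define P where "P = {b \<in> B. l b \<noteq> 0}"
  have A0: "A b = 0" if "b \<in> B - P" for b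
    using that AA[of b b] by (auto simp: P_def)
  have inj: "inj_on A P"
  proof (rule inj_onI)
    fix b c assume "b \<in> P" "c \<in> P" "A b = A c"
    then show "b = c"
      using AA[of b b] AA[of b c] by (auto simp: P_def split: if_splits)
  qed
  have "independent (A ` P)"
  proof (rule pairwise_orthogonal_independent)
    show "pairwise orthogonal (A ` P)"
      using AA by (auto simp: pairwise_def orthogonal_def P_def split: if_splits)
    show "0 \<notin> A ` P"
      using AA by (force simp: P_def)
  qed
  moreover have "range A = span (A ` P)"
  proof -
    have "range A = span (A ` B)"
      using linear_span_image[OF A, of B] sp by simp
    also have "\<dots> = span (A ` P)"
    proof
      have "A ` B \<subseteq> insert 0 (A ` P)"
        using A0 by (auto simp: image_iff)
      then show "span (A ` B) \<subseteq> span (A ` P)"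
        using span_mono span_insert_0 by metis
      show "span (A ` P) \<subseteq> span (A ` B)"
        by (intro span_mono image_mono) (auto simp: P_def)
    qed
    finally show ?thesis .
  qed
  ultimately have rank: "dim (range A) = card P"
    by (metis dim_span_eq_card_independent card_image inj dim_span)
  define R where "R = operator_sqrt G"
  have R_eq: "R = (\<lambda>x. \<Sum>b\<in>B. (sqrt (l b) * (b \<bullet> x)) *\<^sub>R b)"
    unfolding R_def by (rule operator_sqrt_eq[OF G B sp nonneg])
  have linR: "linear R"
    unfolding R_eq by (rule linear_diagonal)
  have Rb: "R b = sqrt (l b) *\<^sub>R b" if "b \<in> B" for b
    unfolding R_eq by (rule diagonal_basis_vector[OF on that])
  define xs where "xs = rev (sorted_list_of_multiset (eigenvalue_mset R))"
  have mset: "mset xs = image_mset (\<lambda>b. sqrt (l b)) (mset_set B)"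
    using eigenvalue_mset_eq[OF linR on sp Rb] by (simp add: xs_def)
  have "length (filter (\<lambda>x. x \<noteq> 0) xs) = size (filter_mset (\<lambda>x. x \<noteq> 0) (mset xs))"
    by (metis mset_filter size_mset)
  also have "\<dots> = card P"
    using fin by (simp add: mset filter_mset_image_mset P_def)
  finally have len: "length (filter (\<lambda>x. x \<noteq> 0) xs) = card P" .
  have "set xs = (\<lambda>b. sqrt (l b)) ` B"
    using fin mset by (metis finite_set_mset_mset_set set_image_mset set_mset_mset)
  then have pos: "x \<ge> 0" if "x \<in> set xs" for x
    using that nonneg by auto
  have sorted: "sorted_wrt (\<ge>) xs"
    unfolding xs_def sorted_wrt_rev by simp
  \<comment> \<open>Singular values are numbered from 1 but list positions from 0, hence the shift
    of the summation range.\<close>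
  have "(\<Sum>i = 1..dim (range A). 1 / (singular_value A i)\<^sup>2) = (\<Sum>i<card P. 1 / (xs ! i)\<^sup>2)"
    unfolding rank singular_value_def G_def[symmetric] R_def[symmetric] xs_def[symmetric]
    by (simp add: sum.atLeast1_atMost_eq)
  also have "\<dots> = sum_list (map (\<lambda>x. 1 / x\<^sup>2) xs)"
    unfolding len[symmetric] using sorted pos by (intro sum_nth_antimono_prefix) auto
  also have "\<dots> = sum_mset (image_mset (\<lambda>x. 1 / x\<^sup>2) (mset xs))"
    by (metis mset_map sum_mset_sum_list)
  also have "\<dots> = (\<Sum>b\<in>B. 1 / (sqrt (l b))\<^sup>2)"
    by (simp add: mset sum_unfold_sum_mset multiset.map_comp comp_def)
  also have "\<dots> = (\<Sum>b\<in>B. 1 / l b)"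
    using nonneg by (intro sum.cong) auto
  finally show thesis
    using that[of B l] B sp nonneg rank by (simp add: G_def P_def)
qed

subsection \<open>Restricted invertibility\<close>

text \<open>The trace at the barrier \<open>-a\<close> splits into the positive eigenvalues, bounded
  through the sum of their reciprocals, and the zero eigenvalues, each contributing exactly
  \<open>1 / a\<close>.\<close>

lemma initial_barrier:
  fixes l :: "'i \<Rightarrow> real" and k :: nat
  assumes fin: "finite B" and nonneg: "\<And>b. b \<in> B \<Longrightarrow> l b \<ge> 0"
    and r: "r = card {b \<in> B. l b \<noteq> 0}" and k: "1 \<le> k" "k < r"
  defines "H \<equiv> (\<Sum>b\<in>B. 1 / l b)"
  obtains a where "a > 0"
    "(sqrt r - sqrt k)\<^sup>2 / (real (card B) * (H / r)) \<le> (real (card B) - real k) / (\<Sum>b\<in>B. 1 / (l b + a)) - a"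
proof -
  define P where "P = {b \<in> B. l b \<noteq> 0}"
  have finP: "finite P" and PB: "P \<subseteq> B" and cardP: "card P = r"
    using fin r by (auto simp: P_def)
  have lpos: "l b > 0" if "b \<in> P" for b
    using that nonneg[of b] by (auto simp: P_def)
  have HP: "H = (\<Sum>b\<in>P. 1 / l b)"
    unfolding H_def using fin by (intro sum.mono_neutral_right) (auto simp: P_def)
  have "P \<noteq> {}" using cardP k by auto
  then have "H > 0"
    unfolding HP using finP lpos by (intro sum_pos) auto
  define m where "m = real (card B)"
  define h where "h = H / r"
  have h: "h > 0" "H = r * h"
    using \<open>H > 0\<close> k by (simp_all add: h_def)
  have rm: "real r \<le> m"
    using card_mono[OF fin PB] cardP by (simp add: m_def)
  \<comment> \<open>This value maximizes
    \<open>(w - 1) * (r - k * w) / w = r + k - k * w - r / w\<close> over positive \<open>w\<close>,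
    with maximum \<open>(sqrt r - sqrt k)\<^sup>2\<close>. Up to the factor \<open>m * h\<close>
    this is the lower bound reached at the end.\<close>
  define w where "w = sqrt r / sqrt k"
  have w: "w > 1"
    using k by (simp add: w_def)
  have rw: "real r = w\<^sup>2 * k" and sw: "sqrt r = w * sqrt k"
    using k by (simp_all add: w_def power_divide)
  define a where "a = (w - 1) / h"
  have a: "a > 0" using w h by (simp add: a_def)
  \<comment> \<open>Cauchy-Schwarz with \<open>w = 1 + (w - 1)\<close>. Equality holds when
    \<open>a = (w - 1) * l b\<close>; the choice of \<open>a\<close> achieves this if
    \<open>l b\<close> is the harmonic mean \<open>1 / h\<close> of the positive
    eigenvalues.\<close>
  have ineq: "1 / (l b + a) \<le> (1 / l b + (w - 1)\<^sup>2 / a) / w\<^sup>2" if b: "b \<in> P" for b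
  proof -
    have "(1 / l b + (w - 1)\<^sup>2 / a) * (l b + a) - w\<^sup>2 = (a - (w - 1) * l b)\<^sup>2 / (a * l b)"
      using a lpos[OF b] by (simp add: field_simps power2_eq_square)
    also have "\<dots> \<ge> 0"
      using a lpos[OF b] by simp
    finally show ?thesis
      using a w lpos[OF b] by (simp add: divide_le_eq le_divide_eq mult.commute)
  qed
  define \<phi> where "\<phi> = (\<Sum>b\<in>B. 1 / (l b + a))"
  have "(\<Sum>b\<in>P. 1 / (l b + a)) \<le> (\<Sum>b\<in>P. (1 / l b + (w - 1)\<^sup>2 / a) / w\<^sup>2)"
    using ineq by (rule sum_mono)
  also have "\<dots> = (H + r * ((w - 1)\<^sup>2 / a)) / w\<^sup>2"
    by (simp add: sum_divide_distrib[symmetric] sum.distrib HP cardP)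
  also have "(w - 1)\<^sup>2 / a = (w - 1) * h"
    using w h by (simp add: a_def power2_eq_square)
  also have "(H + r * ((w - 1) * h)) / w\<^sup>2 = r * h / w"
    using w by (simp add: h power2_eq_square field_simps)
  finally have onP: "(\<Sum>b\<in>P. 1 / (l b + a)) \<le> r * h / w" .
  have "\<phi> = (\<Sum>b\<in>P. 1 / (l b + a)) + (\<Sum>b\<in>B - P. 1 / (l b + a))"
    unfolding \<phi>_def using sum.subset_diff[OF PB fin] by (simp add: add.commute)
  also have "(\<Sum>b\<in>B - P. 1 / (l b + a)) = (\<Sum>b\<in>B - P. 1 / a)"
    by (intro sum.cong) (auto simp: P_def)
  also have "\<dots> = (m - r) / a"
    using PB finP cardP rm fin by (simp add: card_Diff_subset m_def of_nat_diff)
  also have "\<dots> = (m - r) * h / (w - 1)"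
    by (simp add: a_def)
  finally have "\<phi> \<le> r * h / w + (m - r) * h / (w - 1)"
    using onP by simp
  also have "\<dots> = h * (m * w - r) / (w * (w - 1))"
    using w by (simp add: field_simps)
  finally have \<phi>_le: "\<phi> \<le> h * (m * w - r) / (w * (w - 1))" .
  have \<phi>: "\<phi> > 0"
    unfolding \<phi>_def using fin \<open>P \<noteq> {}\<close> PB nonneg a
    by (intro sum_pos) (auto simp: add_nonneg_pos)
  have m: "m > 0" using rm k by simp
  have "m * 1 < m * w"
    using m w by (intro mult_strict_left_mono)
  then have mw: "m * w - r > 0"
    using rm by simp
  have "(sqrt r - sqrt k)\<^sup>2 / (m * h) = (w - 1)\<^sup>2 * k / (m * h)"
    unfolding sw by (simp add: power2_eq_square algebra_simps)
  also have "\<dots> = ((w - 1) / h) * ((real r - k * w) / (m * w))"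
    using w h m by (simp add: rw power2_eq_square field_simps)
  \<comment> \<open>The numerator is nonnegative, so the denominator may be decreased from
    \<open>m * w\<close> to \<open>m * w - r\<close>.\<close>
  also have "\<dots> \<le> ((w - 1) / h) * ((real r - k * w) / (m * w - r))"
  proof (intro mult_left_mono divide_left_mono)
    have "real r - k * w = k * w * (w - 1)"
      by (simp add: rw power2_eq_square algebra_simps)
    then show "0 \<le> real r - k * w" using w by simp
  qed (use w h m mw in auto)
  \<comment> \<open>Adding \<open>a = (w - 1) / h\<close> replaces the numerator
    \<open>r - k * w\<close> by \<open>w * (m - k)\<close>.\<close>
  also have "\<dots> = (m - k) / (h * (m * w - r) / (w * (w - 1))) - a"
    using w h mw by (simp add: a_def field_simps)
  also have "\<dots> \<le> (m - k) / \<phi> - a"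
    using \<phi> \<phi>_le rm k by (intro diff_right_mono divide_left_mono) (use w h mw in auto)
  finally show thesis
    using that[OF a] by (simp add: m_def h_def \<phi>_def)
qed

section \<open>Coordinate subspaces and the inverse of the restricted operator\<close>

lemma coord_incl_nth: "coord_incl \<sigma> a $ j = (if j \<in> \<sigma> then a j else 0)"
  by (simp add: coord_incl_def axis_def if_distrib sum.delta' cong: if_cong)

lemma norm_coord_incl: "norm (coord_incl \<sigma> a) = L2_set a \<sigma>"
proof -
  have "(\<Sum>j\<in>UNIV. (coord_incl \<sigma> a $ j)\<^sup>2) = (\<Sum>j\<in>\<sigma>. (a j)\<^sup>2)"
    by (rule sum.mono_neutral_cong_right) (auto simp: coord_incl_nth)
  then show ?thesis
    by (simp add: norm_vec_def L2_set_def)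
qed

text \<open>Since \<open>coord_incl\<close> preserves norms, the lower bound on the coordinate
  subspace gives injectivity and bounds every quotient in the supremum.\<close>

lemma inv_restr_norm_le:
  fixes A :: "real ^ 'm \<Rightarrow> real ^ 'n"
  assumes A: "linear A" and \<beta>: "\<beta> > 0"
    and bound: "\<And>x. x \<in> span ((\<lambda>j. axis j 1) ` \<sigma>) \<Longrightarrow> \<beta> * norm x \<le> norm (A x)"
  shows "inv_restr_norm A \<sigma> \<le> ereal (1 / \<beta>)"
proof -
  define AJ where "AJ = A \<circ> coord_incl \<sigma>"
  have J: "coord_incl \<sigma> a \<in> span ((\<lambda>j. axis j 1) ` \<sigma>)" for a
    unfolding coord_incl_def by (intro span_sum span_scale span_base) auto
  have inj: "inj_on AJ (extensional \<sigma>)"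
  proof (rule inj_onI)
    fix a b assume ab: "a \<in> extensional \<sigma>" "b \<in> extensional \<sigma>" "AJ a = AJ b"
    have "\<beta> * norm (coord_incl \<sigma> a - coord_incl \<sigma> b)
        \<le> norm (A (coord_incl \<sigma> a - coord_incl \<sigma> b))"
      by (intro bound span_diff J)
    also have "\<dots> = 0"
      using ab(3) by (simp add: AJ_def linear_diff[OF A])
    finally have "coord_incl \<sigma> a = coord_incl \<sigma> b"
      using \<beta> by (simp add: mult_le_0_iff)
    then show "a = b"
      using ab(1,2) by (intro extensionalityI[of a \<sigma> b]) (metis coord_incl_nth)+
  qed
  have "ereal (L2_set (inv_into (extensional \<sigma>) AJ (AJ a)) \<sigma> / norm (AJ a)) \<le> ereal (1 / \<beta>)"
    if a: "a \<in> extensional \<sigma>" for a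
  proof -
    have "\<beta> * L2_set a \<sigma> \<le> norm (AJ a)"
      using bound[OF J] by (simp add: AJ_def norm_coord_incl)
    \<comment> \<open>If \<open>AJ a = 0\<close>, the quotient is 0 because division by zero yields
      0.\<close>
    then have "L2_set a \<sigma> / norm (AJ a) \<le> 1 / \<beta>"
      using \<beta> by (cases "AJ a = 0") (auto simp: field_simps)
    then show ?thesis
      using inv_into_f_f[OF inj a] by simp
  qed
  then show ?thesis
    using inj unfolding inv_restr_norm_def Let_def AJ_def[symmetric] by (auto intro!: SUP_least)
qed

theorem theorem11:
  fixes A :: "real ^ 'm \<Rightarrow> real ^ 'n" and k :: nat
  assumes "k \<ge> 1"
    and "linear A"
    and "dim (range A) > k"
  shows "\<exists>\<sigma> :: 'm set. card \<sigma> = k \<and>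
    inv_restr_norm A \<sigma> \<le>
      ereal (sqrt (real CARD('m)) / (sqrt (real (dim (range A))) - sqrt (real k)) *
             sqrt (1 / real (dim (range A)) *
                   (\<Sum>i = 1..dim (range A). 1 / (singular_value A i)\<^sup>2)))"
proof -
  note A = \<open>linear A\<close>
  define r where "r = dim (range A)"
  define G where "G = adjoint A \<circ> A"
  note G = linear_gram[OF A, folded G_def]
  note GA = inner_gram[OF A, folded G_def]
  note sym = gram_selfadjoint[OF A, folded G_def]
  obtain B l where B: "diagonalizes G B l" "span B = UNIV"
    and nonneg: "\<And>b. b \<in> B \<Longrightarrow> l b \<ge> 0" and rank: "r = card {b \<in> B. l b \<noteq> 0}"
    and sv: "(\<Sum>i = 1..r. 1 / (singular_value A i)\<^sup>2) = (\<Sum>b\<in>B. 1 / l b)"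
    by (rule gram_spectrum[OF A, folded G_def r_def]) (rule that)
  define h where "h = (\<Sum>b\<in>B. 1 / l b) / r"
  have on: "orthonormal B"
    using B by (simp add: diagonalizes_def)
  have cardB: "card B = CARD('m)"
    using orthonormal_card[OF on] B(2) by simp
  have kr: "1 \<le> k" "k < r"
    using assms by (simp_all add: r_def)
  obtain a where a: "a > 0" and bar: "(sqrt r - sqrt k)\<^sup>2 / (real CARD('m) * h)
      \<le> (real CARD('m) - real k) / (\<Sum>b\<in>B. 1 / (l b + a)) - a"
    by (rule initial_barrier[OF orthonormal_finite[OF on] nonneg rank kr, folded h_def, unfolded cardB])
      (assumption, rule that)
  \<comment> \<open>Vectors are removed from the standard basis, whereas traces are computed in
    eigenbases such as \<open>B\<close>; both span the whole space at the start.\<close>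
  define E :: "(real ^ 'm) set" where "E = range (\<lambda>j. axis j 1)"
  have inj: "inj (\<lambda>j. axis j 1 :: real ^ 'm)"
    by (simp add: inj_on_def axis_eq_axis)
  have onE: "orthonormal E"
    by (auto simp: E_def orthonormal_def pairwise_def orthogonal_def inner_axis_axis)
  have spE: "span E = span B"
  proof -
    have "E = Basis"
      by (auto simp: E_def Basis_vec_def)
    then show ?thesis using B by simp
  qed
  have "r \<le> CARD('m)"
    unfolding r_def using dim_image_le[OF A, of UNIV] by simp
  then have cardE: "card E = k + (CARD('m) - k)"
    using kr by (simp add: E_def card_image[OF inj])
  define \<phi> where "\<phi> = (\<Sum>b\<in>B. 1 / (l b + a))"
  have above: "- a < l b" if "b \<in> B" for b
    using nonneg[OF that] a by simp
  have "(\<Sum>b\<in>B. 1 / (l b - - a)) \<le> \<phi>"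
    by (simp add: \<phi>_def)
  from barrier_iterate[OF G sym B(1) onE spE cardE kr(1) above this]
  obtain F where F: "F \<subseteq> E" "card F = k"
    "\<And>x. x \<in> span F \<Longrightarrow> (- a + real (CARD('m) - k) / \<phi>) * (norm x)\<^sup>2 \<le> G x \<bullet> x"
    by blast
  define \<sigma> where "\<sigma> = {j. axis j 1 \<in> F}"
  have F_eq: "F = (\<lambda>j. axis j 1) ` \<sigma>"
    using F(1) by (auto simp: \<sigma>_def E_def)
  have card\<sigma>: "card \<sigma> = k"
    using F(2) inj by (metis F_eq card_image inj_on_subset subset_UNIV)
  \<comment> \<open>The reciprocal of the claimed bound, as \<open>h\<close> is by \<open>sv\<close>
    the mean of the inverse squared singular values up to the rank. Its square is the lower bound
    provided by \<open>bar\<close>.\<close>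
  define \<beta> where "\<beta> = (sqrt r - sqrt k) / (sqrt CARD('m) * sqrt h)"
  have h: "h > 0"
  proof -
    have "{b \<in> B. l b \<noteq> 0} \<noteq> {}"
      using rank kr by (metis card.empty not_less_zero)
    then obtain b where "b \<in> B" "l b \<noteq> 0" by blast
    then have "(\<Sum>b\<in>B. 1 / l b) > 0"
      using orthonormal_finite[OF on] nonneg
      by (intro sum_pos2[of _ b]) (auto simp: less_le)
    then show ?thesis using kr by (simp add: h_def)
  qed
  have \<beta>: "\<beta> > 0"
    using kr h by (simp add: \<beta>_def)
  have "\<beta> * norm x \<le> norm (A x)" if x: "x \<in> span F" for x
  proof -
    have "\<beta>\<^sup>2 = (sqrt r - sqrt k)\<^sup>2 / (real CARD('m) * h)"
      using h by (simp add: \<beta>_def power_divide power_mult_distrib)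
    also have "\<dots> \<le> - a + real (CARD('m) - k) / \<phi>"
      using bar kr \<open>r \<le> CARD('m)\<close> by (simp add: \<phi>_def of_nat_diff)
    finally have "\<beta>\<^sup>2 * (norm x)\<^sup>2 \<le> (- a + real (CARD('m) - k) / \<phi>) * (norm x)\<^sup>2"
      by (intro mult_right_mono) auto
    also have "\<dots> \<le> G x \<bullet> x"
      by (rule F(3)[OF x])
    also have "\<dots> = (norm (A x))\<^sup>2"
      by (simp add: GA dot_square_norm)
    finally show ?thesis
      by (intro power2_le_imp_le[of "\<beta> * norm x"]) (simp_all add: power_mult_distrib)
  qed
  then have "inv_restr_norm A \<sigma> \<le> ereal (1 / \<beta>)"
    using \<beta> F_eq by (intro inv_restr_norm_le[OF A]) auto
  also have "1 / \<beta> = sqrt CARD('m) / (sqrt r - sqrt k) * sqrt (1 / r * (\<Sum>i = 1..r. 1 / (singular_value A i)\<^sup>2))"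
    unfolding sv by (simp add: \<beta>_def h_def)
  finally show ?thesis
    using card\<sigma> unfolding r_def by blast
qed

end
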